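(* For all sufficiently large $X$, \[ \#\{n\le X:\ b_{14}(2n)\text{ is even}\}\gg \sqrt{X/3}. \]
   Context: $b_{14}(n)$ is the number of partitions of $n$ none of whose parts is divisible by $14$; equivalently $\sum_{n\ge0}b_{14}(n)q^n=f_{14}/f_1$ with $f_k=\prod_{j\ge1}(1-q^{jk})$. Here $n$ ranges over nonnegative integers and $\gg$ means bounded below by a positive constant times the right-hand side. *)

theory Defs
  imports Complex_Main "HOL-Library.Multiset"
begin

definition regular_partitions :: "nat \<Rightarrow> nat \<Rightarrow> nat multiset set" where
  "regular_partitions l n =
     {P. (\<forall>p\<in>#P. 0 < p) \<and> sum_mset P = n \<and> (\<forall>p\<in>#P. \<not> l dvd p)}"

definition b :: "nat \<Rightarrow> nat \<Rightarrow> nat" where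
  "b l n = card (regular_partitions l n)"

text \<open>Since \<open>card\<close> is 0 on infinite sets, \<open>b\<close> is a genuine count only because of the following fact.\<close>

lemma finite_regular_partitions: "finite (regular_partitions l n)"
proof (rule finite_subset)
  have size_le: "size P \<le> sum_mset P" if "\<forall>p\<in>#P. 0 < p" for P :: "nat multiset"
    using that by (induction P) auto
  have mem_le: "p \<le> sum_mset P" if "p \<in># P" for p and P :: "nat multiset"
    using that by (auto dest!: multi_member_split)
  show "regular_partitions l n \<subseteq> mset ` {xs. set xs \<subseteq> {..n} \<and> length xs \<le> n}"
  proof
    fix P assume P: "P \<in> regular_partitions l n"
    obtain xs where xs: "mset xs = P" using ex_mset by blast
    have "set xs \<subseteq> {..n}" "length xs \<le> n"
      using P mem_le[of _ P] size_le[of P] xs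
      by (auto simp: regular_partitions_def simp flip: set_mset_mset size_mset)
    then show "P \<in> mset ` {xs. set xs \<subseteq> {..n} \<and> length xs \<le> n}"
      using xs by blast
  qed
  show "finite (mset ` {xs. set xs \<subseteq> {..n} \<and> length xs \<le> n})"
    by (intro finite_imageI finite_lists_length_le) simp
qed

end

theory Submission
  imports Defs "HOL-Library.Z2" "HOL-Computational_Algebra.Formal_Power_Series"
begin

text \<open>
  Modulo 2, \<open>f\<^sub>1\<^sup>2 = f\<^sub>2\<close>, so the generating function \<open>B = f\<^sub>1\<^sub>4 / f\<^sub>1\<close> satisfies
  \<open>B f\<^sub>2 = f\<^sub>1\<^sub>4 f\<^sub>1\<close>. By the pentagonal number theorem an exponent of the right-hand side is
  congruent modulo 7 to a pentagonal number, hence never to 4. Comparing coefficients at \<open>2 n\<close> for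
  \<open>n \<equiv> 2\<close> modulo 7, the sum of \<open>b\<^sub>1\<^sub>4(2 (n - \<omega>))\<close> over the pentagonal numbers \<open>\<omega> \<le> n\<close> is even.
  If there is an odd number of such \<open>\<omega>\<close>, some summand is even. A positive proportion of all
  \<open>n \<le> X\<close> has these two properties, and each is the sum of a pentagonal number (of which there are
  \<open>O(\<surd>X)\<close>) and some \<open>m \<le> X\<close> with \<open>b\<^sub>1\<^sub>4(2 m)\<close> even.
\<close>

section \<open>The pentagonal number theorem\<close>

text \<open>Indexing by all integers gives the generalised pentagonal numbers of Euler's theorem.
  Neither \<open>div\<close> nor \<open>nat\<close> loses anything, as \<open>two_pentagonal\<close>
  confirms.\<close>

definition pentagonal :: "int \<Rightarrow> nat" where
  "pentagonal k = nat (k * (3 * k - 1) div 2)"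

lemma two_pentagonal: "2 * int (pentagonal k) = k * (3 * k - 1)"
proof -
  have "even (k * (3 * k - 1))" by simp
  moreover have "k * (3 * k - 1) \<ge> 0"
    by (cases "k \<le> 0") (auto simp: mult_nonpos_nonpos)
  ultimately show ?thesis by (simp add: pentagonal_def)
qed

lemma two_choose_two: "2 * int (Suc n choose 2) = int n * (int n + 1)"
proof -
  have "even (Suc n * n)" by simp
  hence "2 * (Suc n choose 2) = Suc n * n"
    by (simp only: choose_two diff_Suc_1) simp
  from arg_cong[OF this, of int] show ?thesis by (simp add: algebra_simps)
qed

lemma pentagonal_of_nat: "pentagonal (int (Suc n)) = Suc n * Suc n + (Suc n choose 2)"
  using two_pentagonal[of "int (Suc n)"] two_choose_two[of n]
  by (simp only: flip: of_nat_eq_iff[where 'a=int]) (simp add: algebra_simps)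

lemma pentagonal_of_neg: "pentagonal (- int n) = n * n + (Suc n choose 2)"
  using two_pentagonal[of "- int n"] two_choose_two[of n]
  by (simp only: flip: of_nat_eq_iff[where 'a=int]) (simp add: algebra_simps)

lemma abs_le_pentagonal: "\<bar>k\<bar> \<le> int (pentagonal k)"
proof -
  have "2 * \<bar>k\<bar> \<le> 2 * (k * k)"
    by (smt (verit) mult_left_mono mult_minus_left mult_minus_right mult_cancel_left1)
  moreover have "k \<le> k * k"
    by (smt (verit) mult_left_mono zero_le_square mult_cancel_left1)
  ultimately show ?thesis
    using two_pentagonal[of k] by (simp add: algebra_simps)
qed

text \<open>Twice the right side is \<open>2 * k * k\<close> plus the nonnegative
  \<open>k * k - k\<close>. This makes the number of pentagonal numbers up to x of order sqrt
  x.\<close>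

lemma square_le_pentagonal: "k * k \<le> int (pentagonal k)"
proof -
  have "k \<le> k * k"
    by (smt (verit) mult_left_mono zero_le_square mult_cancel_left1)
  thus ?thesis using two_pentagonal[of k] by (simp add: algebra_simps)
qed

lemma finite_pentagonal_le: "finite {k. pentagonal k \<le> n}"
proof (rule finite_subset)
  show "{k. pentagonal k \<le> n} \<subseteq> {- int n..int n}"
  proof
    fix k assume "k \<in> {k. pentagonal k \<le> n}"
    thus "k \<in> {- int n..int n}" using abs_le_pentagonal[of k] by auto
  qed
qed simp

definition pentagonal_sum :: "'a::comm_ring_1 \<Rightarrow> nat \<Rightarrow> 'a" where
  "pentagonal_sum q n = (\<Sum>k\<in>{- int n..int n}. (-1) ^ nat \<bar>k\<bar> * q ^ pentagonal k)"

text \<open>The exponents of the new indices \<open>Suc n\<close> and \<open>- Suc n\<close> are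
  kept in binomial form, so that the increment is literally the one in
  \<open>shanks_sum_Suc\<close>.\<close>

lemma pentagonal_sum_Suc:
  "pentagonal_sum q (Suc n) = pentagonal_sum q n +
     (-1) ^ Suc n * (q ^ (Suc n * Suc n + (Suc n choose 2)) +
                     q ^ (Suc n * Suc n + (Suc (Suc n) choose 2)))"
proof -
  have "{- int (Suc n)..int (Suc n)} =
      insert (int (Suc n)) (insert (- int (Suc n)) {- int n..int n})"
    by auto
  thus ?thesis
    unfolding pentagonal_sum_def
    by (simp del: of_nat_Suc binomial_Suc_Suc add: pentagonal_of_nat pentagonal_of_neg algebra_simps)
qed

text \<open>Shanks's finite form of the theorem: this sum telescopes in \<open>n\<close> to the partial sum of the
  pentagonal series, and its terms with \<open>s > 0\<close> are divisible by \<open>q ^ Suc n\<close>.\<close>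

definition shanks_sum :: "'a::comm_ring_1 \<Rightarrow> nat \<Rightarrow> 'a" where
  "shanks_sum q n =
     (\<Sum>s\<le>n. (-1) ^ s * (\<Prod>j\<in>{s<..n}. 1 - q ^ j) * q ^ (s * n + (Suc s choose 2)))"

lemma shanks_sum_Suc:
  "shanks_sum q (Suc n) = shanks_sum q n +
     (-1) ^ Suc n * (q ^ (Suc n * Suc n + (Suc n choose 2)) +
                     q ^ (Suc n * Suc n + (Suc (Suc n) choose 2)))"
proof -
  define P where "P s = (\<Prod>j\<in>{s<..n}. 1 - q ^ j)" for s
  define u where "u s = (-1) ^ s * P s * q ^ (s * n + (Suc s choose 2))" for s
  define v where "v s = (-1) ^ s * P s * q ^ (Suc s * Suc n + (Suc s choose 2))" for s
  define w where "w s = u s * (1 - q ^ s)" for s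
  have T: "(Suc (Suc s) choose 2) = Suc s + (Suc s choose 2)" for s
    by (simp add: numeral_2_eq_2)
  \<comment> \<open>Expand the new factor \<open>1 - q ^ Suc n\<close>: its second term gives
    \<open>v s\<close>, its first gives \<open>u s * q ^ s = u s - w s\<close>. By
    \<open>w_Suc\<close> the \<open>w\<close> and \<open>v\<close> sums then cancel except for
    \<open>v n\<close>.\<close>
  have split: "(-1) ^ s * (\<Prod>j\<in>{s<..Suc n}. 1 - q ^ j) * q ^ (s * Suc n + (Suc s choose 2))
      = u s - w s - v s" if "s \<le> n" for s
  proof -
    have "{s<..Suc n} = insert (Suc n) {s<..n}" using that by auto
    hence P_Suc: "(\<Prod>j\<in>{s<..Suc n}. 1 - q ^ j) = (1 - q ^ Suc n) * P s"
      unfolding P_def by simp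
    show ?thesis
      unfolding u_def v_def w_def P_Suc
      by (simp add: power_add algebra_simps del: binomial_Suc_Suc)
  qed
  have w_Suc: "w (Suc r) = - v r" if "r < n" for r
  proof -
    have "{r<..n} = insert (Suc r) {Suc r<..n}" using that by auto
    hence "P r = (1 - q ^ Suc r) * P (Suc r)" unfolding P_def by simp
    moreover have "Suc r * n + (Suc (Suc r) choose 2) = Suc r * Suc n + (Suc r choose 2)"
      unfolding T by simp
    ultimately show ?thesis
      unfolding w_def u_def v_def by (simp only:) (simp add: algebra_simps del: binomial_Suc_Suc)
  qed
  have "(\<Sum>s\<le>n. w s) = w 0 + (\<Sum>r<n. w (Suc r))"
    by (rule sum.atMost_shift)
  also have "\<dots> = - (\<Sum>r<n. v r)"
    using w_Suc by (simp add: w_def sum_negf)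
  finally have w_sum: "(\<Sum>s\<le>n. w s) = - (\<Sum>r<n. v r)" .
  have v_sum: "(\<Sum>s\<le>n. v s) = (\<Sum>r<n. v r) + v n"
    by (simp add: lessThan_Suc_atMost[symmetric])
  have "shanks_sum q (Suc n) = (\<Sum>s\<le>n. u s - w s - v s) +
      (-1) ^ Suc n * q ^ (Suc n * Suc n + (Suc (Suc n) choose 2))"
    unfolding shanks_sum_def using split by (simp del: binomial_Suc_Suc)
  also have "\<dots> = (\<Sum>s\<le>n. u s) - v n +
      (-1) ^ Suc n * q ^ (Suc n * Suc n + (Suc (Suc n) choose 2))"
    by (simp add: sum_subtractf w_sum v_sum del: binomial_Suc_Suc)
  also have "v n = (-1) ^ n * q ^ (Suc n * Suc n + (Suc n choose 2))"
    unfolding v_def P_def by simp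
  also have "(\<Sum>s\<le>n. u s) = shanks_sum q n"
    unfolding shanks_sum_def u_def P_def ..
  finally show ?thesis by (simp add: algebra_simps del: binomial_Suc_Suc)
qed

lemma shanks_identity: "shanks_sum q n = pentagonal_sum q n"
proof (induction n)
  case 0
  show ?case by (simp add: shanks_sum_def pentagonal_sum_def pentagonal_def binomial_eq_0)
next
  case (Suc n)
  thus ?case by (simp only: shanks_sum_Suc pentagonal_sum_Suc)
qed

text \<open>Congruence modulo \<open>q ^ Suc n\<close> replaces convergence of the infinite product,
  so \<open>q\<close> may be any ring element, in particular a power of
  \<open>fps_X\<close>.\<close>

theorem pentagonal_number_theorem:
  "q ^ Suc n dvd pentagonal_sum q n - (\<Prod>j\<in>{1..n}. 1 - q ^ j)"
proof -
  let ?t = "\<lambda>s. (-1) ^ s * (\<Prod>j\<in>{s<..n}. 1 - q ^ j) * q ^ (s * n + (Suc s choose 2))"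
  have "pentagonal_sum q n = ?t 0 + (\<Sum>r<n. ?t (Suc r))"
    unfolding shanks_identity[symmetric] shanks_sum_def by (rule sum.atMost_shift)
  also have "?t 0 = (\<Prod>j\<in>{1..n}. 1 - q ^ j)"
    by (simp add: numeral_2_eq_2 atLeastSucAtMost_greaterThanAtMost)
  finally have "pentagonal_sum q n - (\<Prod>j\<in>{1..n}. 1 - q ^ j) = (\<Sum>r<n. ?t (Suc r))"
    by simp
  moreover have "q ^ Suc n dvd ?t (Suc r)" for r
  proof -
    have "Suc n \<le> Suc r * n + (Suc (Suc r) choose 2)"
      by (simp add: numeral_2_eq_2)
    thus ?thesis by (intro dvd_mult le_imp_power_dvd)
  qed
  ultimately show ?thesis by (simp only: dvd_sum)
qed

section \<open>Generating functions of restricted partitions\<close>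

definition partitions_in :: "nat set \<Rightarrow> nat \<Rightarrow> nat multiset set" where
  "partitions_in S n = {P. set_mset P \<subseteq> S \<and> sum_mset P = n}"

definition partition_fps :: "nat set \<Rightarrow> 'a::comm_ring_1 fps" where
  "partition_fps S = Abs_fps (\<lambda>n. of_nat (card (partitions_in S n)))"

lemma finite_partitions_in:
  assumes "0 \<notin> S"
  shows "finite (partitions_in S n)"
\<comment> \<open>Since 0 divides only 0, a 0-regular partition is just one with positive
  parts.\<close>
proof (rule finite_subset[OF _ finite_regular_partitions[of 0 n]])
  show "partitions_in S n \<subseteq> regular_partitions 0 n"
    using assms by (auto simp: partitions_in_def regular_partitions_def intro!: Nat.gr0I)
qed

text \<open>Partitions containing \<open>j\<close> correspond to partitions of \<open>n - j\<close>
  by removing one copy of \<open>j\<close>.\<close>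

lemma card_partitions_in_insert:
  assumes "j \<notin> S" "0 \<notin> S" "0 < j"
  shows "card (partitions_in (insert j S) n) = card (partitions_in S n) +
           (if n < j then 0 else card (partitions_in (insert j S) (n - j)))"
proof -
  let ?A = "if n < j then {} else add_mset j ` partitions_in (insert j S) (n - j)"
  have "partitions_in (insert j S) n = partitions_in S n \<union> ?A"
  proof (intro equalityI subsetI)
    fix P assume P: "P \<in> partitions_in (insert j S) n"
    show "P \<in> partitions_in S n \<union> ?A"
    proof (cases "j \<in># P")
      case True
      then obtain Q where "P = add_mset j Q" by (auto dest: multi_member_split)
      thus ?thesis using P by (auto simp: partitions_in_def)
    next
      case False
      thus ?thesis using P by (auto simp: partitions_in_def)
    qed
  next
    fix P assume "P \<in> partitions_in S n \<union> ?A"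
    thus "P \<in> partitions_in (insert j S) n"
      by (auto simp: partitions_in_def split: if_splits)
  qed
  moreover have "partitions_in S n \<inter> ?A = {}"
  proof -
    have "j \<in># P" if "P \<in> ?A" for P using that by (auto split: if_splits)
    moreover have "j \<notin># P" if "P \<in> partitions_in S n" for P
      using that assms(1) unfolding partitions_in_def by blast
    ultimately show ?thesis by blast
  qed
  moreover have "finite (partitions_in S n)" "finite (partitions_in (insert j S) (n - j))"
    using assms by (simp_all add: finite_partitions_in)
  hence "finite (partitions_in S n)" "finite ?A" by simp_all
  moreover have "card ?A = (if n < j then 0 else card (partitions_in (insert j S) (n - j)))"
    by (simp add: card_image inj_on_def)
  ultimately show ?thesis by (simp add: card_Un_disjoint)
qed

lemma partition_fps_insert:
  assumes "j \<notin> S" "0 \<notin> S" "0 < j"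
  shows "partition_fps (insert j S) * (1 - fps_X ^ j) = partition_fps S"
proof (rule fps_ext)
  fix n
  show "fps_nth (partition_fps (insert j S) * (1 - fps_X ^ j)) n = fps_nth (partition_fps S :: 'a fps) n"
    using card_partitions_in_insert[OF assms, of n]
    by (simp add: right_diff_distrib fps_X_power_mult_right_nth partition_fps_def)
qed

lemma partition_fps_mult_prod:
  assumes "finite S" "0 \<notin> S"
  shows "partition_fps S * (\<Prod>j\<in>S. 1 - fps_X ^ j) = (1 :: 'a::comm_ring_1 fps)"
  using assms
proof (induction S rule: finite_induct)
  case empty
  have "partitions_in {} n = (if n = 0 then {{#}} else {})" for n
    by (auto simp: partitions_in_def)
  thus ?case by (auto simp: partition_fps_def fps_eq_iff)
next
  case (insert j S)
  have "partition_fps (insert j S) * (\<Prod>i\<in>insert j S. 1 - fps_X ^ i) =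
      (partition_fps (insert j S) * (1 - fps_X ^ j)) * (\<Prod>i\<in>S. 1 - fps_X ^ i :: 'a fps)"
    using insert.hyps by (simp add: mult.assoc)
  also have "\<dots> = 1" using insert by (subst partition_fps_insert) auto
  finally show ?case .
qed

lemma regular_partitions_eq_partitions_in:
  assumes "n \<le> N"
  shows "regular_partitions l n = partitions_in {j \<in> {1..N}. \<not> l dvd j} n"
proof -
  have "p \<le> sum_mset P" if "p \<in># P" for p and P :: "nat multiset"
    using that by (auto dest!: multi_member_split)
  hence "p \<le> N" if "p \<in># P" "sum_mset P = n" for p P
    using that assms by (meson le_trans order_eq_refl)
  thus ?thesis
    by (auto simp: regular_partitions_def partitions_in_def subset_iff Suc_le_eq)
qed

text \<open>A truncated form of B f_1 = f_l: the factors at non-multiples of \<open>l\<close> cancel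
  against the generating function, leaving those at \<open>l * 1\<close>, ...,
  \<open>l * n\<close>.\<close>

lemma regular_partition_fps_mult_prod:
  assumes "0 < l"
  shows "partition_fps {j \<in> {1..l * n}. \<not> l dvd j} * (\<Prod>j\<in>{1..l * n}. 1 - fps_X ^ j) =
           (\<Prod>j\<in>{1..n}. 1 - (fps_X ^ l) ^ j :: 'a::comm_ring_1 fps)"
proof -
  let ?S = "{j \<in> {1..l * n}. \<not> l dvd j}"
  have split: "{1..l * n} = ?S \<union> (*) l ` {1..n}"
    using assms by (auto simp: dvd_def)
  have "(\<Prod>j\<in>{1..l * n}. 1 - fps_X ^ j :: 'a fps) =
      (\<Prod>j\<in>?S. 1 - fps_X ^ j) * (\<Prod>j\<in>(*) l ` {1..n}. 1 - fps_X ^ j)"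
    by (subst split, rule prod.union_disjoint) auto
  also have "(\<Prod>j\<in>(*) l ` {1..n}. 1 - fps_X ^ j :: 'a fps) = (\<Prod>j\<in>{1..n}. 1 - (fps_X ^ l) ^ j)"
    using assms by (subst prod.reindex) (auto simp: inj_on_def power_mult)
  finally show ?thesis
    using partition_fps_mult_prod[of ?S, where 'a = 'a] by (simp add: mult.assoc[symmetric])
qed

section \<open>A recurrence modulo 2\<close>

lemma fps_bit_add_self: "(f :: bit fps) + f = 0"
proof (rule fps_ext)
  show "fps_nth (f + f) n = fps_nth 0 n" for n
    by (cases "fps_nth f n") (simp_all only: fps_add_nth fps_zero_nth, simp_all)
qed

lemma fps_bit_uminus: "- (f :: bit fps) = f"
  by (rule minus_unique[OF fps_bit_add_self])

lemma fps_bit_prod_squared: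
  "(\<Prod>j\<in>A. 1 - q ^ j) * (\<Prod>j\<in>A. 1 - q ^ j) = (\<Prod>j\<in>A. 1 - (q ^ 2) ^ j :: bit fps)"
proof -
  have "(1 - x) * (1 - x) = 1 - x ^ 2" for x :: "bit fps"
  proof -
    have "(1 - x) * (1 - x) = 1 - x ^ 2 - (x + x) + (x ^ 2 + x ^ 2)"
      by (simp add: algebra_simps power2_eq_square)
    thus ?thesis by (simp only: fps_bit_add_self) simp
  qed
  moreover have "(q ^ 2) ^ j = (q ^ j) ^ 2" for j
    by (simp add: power_mult[symmetric] mult.commute)
  ultimately show ?thesis by (simp only: prod.distrib[symmetric])
qed

lemma pentagonal_sum_bit:
  "pentagonal_sum (q :: bit fps) n = (\<Sum>k\<in>{- int n..int n}. q ^ pentagonal k)"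
  unfolding pentagonal_sum_def fps_bit_uminus[of 1] by simp

text \<open>Otherwise \<open>k * (3 * k - 1)\<close> would be 1 modulo 7, but its residues are only
  0, 2, 3, 4; the discriminant 13 is a nonresidue.\<close>

lemma pentagonal_mod_7: "pentagonal k mod 7 \<noteq> 4"
proof
  assume *: "pentagonal k mod 7 = 4"
  have "(2 * int (pentagonal k)) mod 7 = (2 * (int (pentagonal k) mod 7)) mod 7"
    by (simp add: mod_simps)
  also have "int (pentagonal k) mod 7 = 4"
    using arg_cong[OF *, of int] by (simp add: zmod_int)
  finally have 1: "(k * (3 * k - 1)) mod 7 = 1" by (simp add: two_pentagonal)
  have "k mod 7 \<in> {0, 1, 2, 3, 4, 5, 6}" by auto
  moreover have "(k * (3 * k - 1)) mod 7 = ((k mod 7) * (3 * (k mod 7) - 1)) mod 7"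
    by (intro mod_mult_cong mod_diff_cong) (simp_all add: mod_simps)
  ultimately show False using 1 by auto
qed

lemma dvd_diff_mult:
  fixes d a a' x x' :: "'a::comm_ring_1"
  assumes "d dvd a - a'" "d dvd x - x'"
  shows "d dvd a * x - a' * x'"
proof -
  have "a * x - a' * x' = (a - a') * x + a' * (x - x')" by (simp add: algebra_simps)
  thus ?thesis using assms by simp
qed

lemma dvd_diff_trans:
  fixes d x y z :: "'a::comm_ring_1"
  assumes "d dvd x - z" "d dvd y - z"
  shows "d dvd x - y"
  using dvd_diff[OF assms] by simp

lemma fps_nth_eq_if_dvd_diff:
  assumes "fps_X ^ Suc n dvd f - (g :: 'a::comm_ring_1 fps)"
  shows "fps_nth f n = fps_nth g n"
proof -
  from assms obtain h where "f - g = fps_X ^ Suc n * h" by (auto simp: dvd_def)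
  hence "fps_nth (f - g) n = 0" by (simp only: fps_X_power_mult_nth) simp
  thus ?thesis by simp
qed

lemma even_sum_regular_partitions:
  assumes n: "n mod 7 = 2"
  shows "even (\<Sum>k | pentagonal k \<le> n. b 14 (2 * (n - pentagonal k)))"
proof -
  let ?X = "fps_X :: bit fps"
  let ?d = "?X ^ Suc (2 * n)"
  let ?B = "partition_fps {j \<in> {1..14 * n}. \<not> 14 dvd j} :: bit fps"
  \<comment> \<open>The error is a multiple of \<open>?X ^ (i * (m + 1))\<close>, whose exponent
    exceeds \<open>2 * n\<close>.\<close>
  have approx: "?d dvd pentagonal_sum (?X ^ i) m - (\<Prod>j\<in>{1..m}. 1 - (?X ^ i) ^ j)"
    if "2 * n \<le> i * m" "0 < i" for i m
  proof (rule dvd_trans[OF _ pentagonal_number_theorem])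
    show "?d dvd (?X ^ i) ^ Suc m"
      unfolding power_mult[symmetric] using that by (intro le_imp_power_dvd) auto
  qed
  \<comment> \<open>\<open>A\<close> is the common truncated product behind B f_2 = f_14 f_1; each
    side with pentagonal sums in place of products is congruent to it modulo
    \<open>?d\<close>.\<close>
  define A where "A = ?B * (\<Prod>j\<in>{1..14 * n}. 1 - (?X ^ 2) ^ j)"
  have A: "A = (\<Prod>j\<in>{1..n}. 1 - (?X ^ 14) ^ j) * (\<Prod>j\<in>{1..14 * n}. 1 - (?X ^ 1) ^ j)"
    unfolding A_def fps_bit_prod_squared[symmetric] mult.assoc[symmetric]
    by (subst regular_partition_fps_mult_prod) simp_all
  have "?d dvd ?B * pentagonal_sum (?X ^ 2) (14 * n) - A"
    unfolding A_def by (intro dvd_diff_mult approx) simp_all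
  moreover have "?d dvd pentagonal_sum (?X ^ 14) n * pentagonal_sum (?X ^ 1) (14 * n) - A"
    unfolding A by (intro dvd_diff_mult approx) simp_all
  ultimately have "?d dvd ?B * pentagonal_sum (?X ^ 2) (14 * n) -
      pentagonal_sum (?X ^ 14) n * pentagonal_sum (?X ^ 1) (14 * n)"
    by (rule dvd_diff_trans)
  hence "fps_nth (?B * pentagonal_sum (?X ^ 2) (14 * n)) (2 * n) =
      fps_nth (pentagonal_sum (?X ^ 14) n * pentagonal_sum (?X ^ 1) (14 * n)) (2 * n)"
    by (rule fps_nth_eq_if_dvd_diff)
  also have "\<dots> = 0"
  proof -
    have "2 * n \<noteq> 14 * pentagonal k + pentagonal l" for k l
    proof
      assume "2 * n = 14 * pentagonal k + pentagonal l"
      hence "2 * n = pentagonal l + 7 * (2 * pentagonal k)" by simp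
      hence "pentagonal l mod 7 = (2 * n) mod 7" by (simp only: mod_mult_self2)
      also have "\<dots> = 4" using n by presburger
      finally show False using pentagonal_mod_7 by blast
    qed
    thus ?thesis
      by (simp add: pentagonal_sum_bit sum_product fps_sum_nth power_mult[symmetric]
          power_add[symmetric] fps_X_power_nth)
  qed
  also have "fps_nth (?B * pentagonal_sum (?X ^ 2) (14 * n)) (2 * n) =
      (\<Sum>k\<in>{- int (14 * n)..int (14 * n)}.
         if pentagonal k \<le> n then of_nat (b 14 (2 * (n - pentagonal k))) else 0)"
    unfolding pentagonal_sum_bit sum_distrib_left fps_sum_nth power_mult[symmetric]
  proof (intro sum.cong refl)
    fix k
    have "of_nat (b 14 m) = fps_nth ?B m" if "m \<le> 14 * n" for m
      using that by (simp add: b_def regular_partitions_eq_partitions_in partition_fps_def)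
    from this[of "2 * (n - pentagonal k)"]
    show "fps_nth (?B * ?X ^ (2 * pentagonal k)) (2 * n) =
        (if pentagonal k \<le> n then of_nat (b 14 (2 * (n - pentagonal k))) else 0)"
      by (simp add: fps_X_power_mult_right_nth diff_mult_distrib2 not_less)
  qed
  also have "\<dots> = (\<Sum>k | pentagonal k \<le> n. of_nat (b 14 (2 * (n - pentagonal k))))"
  proof (rule sum.mono_neutral_cong_right)
    show "{k. pentagonal k \<le> n} \<subseteq> {- int (14 * n)..int (14 * n)}"
    proof
      fix k assume "k \<in> {k. pentagonal k \<le> n}"
      thus "k \<in> {- int (14 * n)..int (14 * n)}" using abs_le_pentagonal[of k] by auto
    qed
  qed auto
  also have "\<dots> = of_nat (\<Sum>k | pentagonal k \<le> n. b 14 (2 * (n - pentagonal k)))"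
    by simp
  finally have "(of_nat (\<Sum>k | pentagonal k \<le> n. b 14 (2 * (n - pentagonal k))) :: bit) = 0" .
  moreover have "(of_nat m :: bit) = 0 \<longleftrightarrow> even m" for m
    by (induction m) auto
  ultimately show ?thesis by blast
qed

section \<open>Counting even values\<close>

text \<open>In increasing order the indices run 0, 1, -1, 2, -2, and so on. The successor of
  \<open>pentagonal (- int s)\<close> is \<open>pentagonal (int s + 1)\<close>, larger by
  \<open>2 * s + 1\<close>.\<close>

lemma pentagonal_le_iff:
  assumes "pentagonal (- int s) \<le> n" "n \<le> pentagonal (- int s) + 2 * s"
  shows "pentagonal k \<le> n \<longleftrightarrow> - int s \<le> k \<and> k \<le> int s"
proof
  have s: "2 * int (pentagonal (- int s)) = int s * (3 * int s + 1)"
    by (simp add: two_pentagonal algebra_simps)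
  note k = two_pentagonal[of k]
  {
    assume "- int s \<le> k \<and> k \<le> int s"
    \<comment> \<open>This product is twice \<open>pentagonal (- int s)\<close> minus twice
      \<open>pentagonal k\<close>.\<close>
    hence "(int s + k) * (3 * (int s - k) + 1) \<ge> 0" by simp
    hence "int s * (3 * int s + 1) + 2 * k \<ge> k * (3 * k - 1) + 2 * k"
      by (simp add: algebra_simps)
    thus "pentagonal k \<le> n" using s k assms by linarith
  next
    assume le: "pentagonal k \<le> n"
    show "- int s \<le> k \<and> k \<le> int s"
    proof (rule ccontr)
      assume "\<not> ?thesis"
      hence "k \<ge> int s + 1 \<or> - k \<ge> int s + 1" by linarith
      hence "k * (3 * k - 1) \<ge> (int s + 1) * (3 * int s + 2)"
      proof
        assume "k \<ge> int s + 1"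
        thus ?thesis by (intro mult_mono) auto
      next
        assume "- k \<ge> int s + 1"
        hence "(- k) * (1 - 3 * k) \<ge> (int s + 1) * (3 * int s + 2)" by (intro mult_mono) auto
        thus ?thesis by (simp add: algebra_simps)
      qed
      hence "2 * int (pentagonal k) \<ge> 2 * int (pentagonal (- int s)) + 4 * int s + 2"
        unfolding s k by (simp add: algebra_simps)
      thus False using le assms by linarith
    qed
  }
qed

text \<open>Exactly \<open>2 * s + 1\<close> indices contribute, and an odd number of odd summands
  cannot have an even sum.\<close>

lemma exists_even_regular_partitions:
  assumes "n mod 7 = 2" "pentagonal (- int s) \<le> n" "n \<le> pentagonal (- int s) + 2 * s"
  shows "\<exists>k. pentagonal k \<le> n \<and> even (b 14 (2 * (n - pentagonal k)))"
proof (rule ccontr)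
  assume "\<not> ?thesis"
  hence odd: "odd (b 14 (2 * (n - pentagonal k)))" if "pentagonal k \<le> n" for k
    using that by blast
  have "{k. pentagonal k \<le> n} = {- int s..int s}"
    by (intro set_eqI) (simp add: pentagonal_le_iff[OF assms(2,3)])
  hence "odd (card {k. pentagonal k \<le> n})" by (simp add: even_nat_iff)
  moreover have "even (\<Sum>k\<in>A. b 14 (2 * (n - pentagonal k))) \<longleftrightarrow> even (card A)"
    if "finite A" "A \<subseteq> {k. pentagonal k \<le> n}" for A
    using that odd by (induction A rule: finite_induct) auto
  ultimately show False
    using even_sum_regular_partitions[OF assms(1)] finite_pentagonal_le[of n] by blast
qed

lemma card_even_ge:
  fixes u :: nat
  assumes "0 < u"
  shows "2 * u \<le> 37 * card {m. m \<le> 301 * u\<^sup>2 \<and> even (b 14 (2 * m))}"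
proof -
  let ?x = "301 * u\<^sup>2"
  define E where "E = {m. m \<le> ?x \<and> even (b 14 (2 * m))}"
  define K where "K = {k. pentagonal k \<le> ?x}"
  \<comment> \<open>The values of \<open>f\<close> on \<open>D\<close> are congruent to 2 modulo 7 because \<open>pentagonal (- 7 v)\<close> is divisible by 7.\<close>
  define f where "f = (\<lambda>(v, i). pentagonal (- int (7 * v)) + 7 * i + 2)"
  \<comment> \<open>For \<open>u \<le> v\<close> and \<open>i < 2 * u\<close> the offset
    \<open>7 * i + 2\<close> stays below \<open>2 * (7 * v)\<close>, as
    \<open>pentagonal_le_iff\<close> requires with \<open>s = 7 * v\<close>.\<close>
  define D where "D = {u..<2 * u} \<times> {..<2 * u}"
  have fin: "finite E" "finite K"
    unfolding E_def K_def by (auto simp: finite_pentagonal_le)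
  have pent: "2 * int (pentagonal (- int (7 * v))) = 7 * (int v * (21 * int v + 1))" for v
    by (simp add: two_pentagonal algebra_simps)
  \<comment> \<open>Raising \<open>v\<close> lifts the pentagonal term by at least
    \<open>147 * v + 77\<close>, while \<open>7 * i\<close> stays below
    \<open>14 * u \<le> 14 * v\<close>.\<close>
  have less: "f (v, i) < f (w, j)" if "v < w" "(v, i) \<in> D" "(w, j) \<in> D" for v i w j
  proof -
    have "int w * (21 * int w + 1) \<ge> (int v + 1) * (21 * (int v + 1) + 1)"
      using that by (intro mult_mono) auto
    hence "int w * (21 * int w + 1) \<ge> int v * (21 * int v + 1) + 42 * int v + 22"
      by (simp add: algebra_simps)
    thus ?thesis using pent[of v] pent[of w] that unfolding f_def D_def by auto
  qed
  have "inj_on f D"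
  proof (rule inj_onI)
    fix p p' assume *: "p \<in> D" "p' \<in> D" "f p = f p'"
    obtain v i w j where [simp]: "p = (v, i)" "p' = (w, j)" by (cases p, cases p')
    have "v = w" using less[of v w i j] less[of w v j i] * by (cases v w rule: linorder_cases) auto
    thus "p = p'" using * by (simp add: f_def)
  qed
  have "f ` D \<subseteq> (\<lambda>(m, k). m + pentagonal k) ` (E \<times> K)"
  proof
    fix n assume "n \<in> f ` D"
    then obtain v i where vi: "u \<le> v" "v < 2 * u" "i < 2 * u"
      and n: "n = pentagonal (- int (7 * v)) + 7 * i + 2"
      by (auto simp: f_def D_def)
    \<comment> \<open>The estimate gives n at most \<open>294 * u\<^sup>2\<close>, within the bound
      \<open>?x\<close>.\<close>
    have "int v * (21 * int v + 1) \<le> (2 * int u - 1) * (42 * int u)"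
      using vi by (intro mult_mono) auto
    hence "2 * int n \<le> 7 * ((2 * int u - 1) * (42 * int u)) + 28 * int u"
      using pent[of v] vi n by simp
    hence "int n \<le> int ?x"
      using assms by (simp add: algebra_simps power2_eq_square)
    hence nx: "n \<le> ?x" by (simp only: of_nat_le_iff)
    have "even (int v * (21 * int v + 1))" by simp
    then obtain t where "int v * (21 * int v + 1) = 2 * t" by (rule evenE)
    hence "7 dvd pentagonal (- int (7 * v))" using pent[of v] by presburger
    hence "n mod 7 = 2" unfolding n by presburger
    then obtain k where k: "pentagonal k \<le> n" "even (b 14 (2 * (n - pentagonal k)))"
      using exists_even_regular_partitions[of n "7 * v"] n vi by auto
    have "(n - pentagonal k, k) \<in> E \<times> K"
      using k nx by (auto simp: E_def K_def)
    thus "n \<in> (\<lambda>(m, k). m + pentagonal k) ` (E \<times> K)"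
      using k(1) by (force intro: image_eqI)
  qed
  hence "card (f ` D) \<le> card (E \<times> K)"
    using fin by (meson card_image_le card_mono finite_SigmaI finite_imageI le_trans)
  hence D: "u * (2 * u) \<le> card E * card K"
    using \<open>inj_on f D\<close> by (simp add: card_image D_def card_cartesian_product)
  \<comment> \<open>As 301 < 18^2, the indices lie within \<open>18 * u\<close> of 0, so there are
    at most \<open>36 * u + 1 \<le> 37 * u\<close> of them.\<close>
  have "K \<subseteq> {- int (18 * u)..int (18 * u)}"
  proof
    fix k assume "k \<in> K"
    hence "int (pentagonal k) \<le> int ?x" unfolding K_def by (simp only: mem_Collect_eq of_nat_le_iff)
    hence "k\<^sup>2 \<le> (18 * int u)\<^sup>2"
      using square_le_pentagonal[of k] zero_le_square[of "int u"]
      by (simp add: power2_eq_square)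
    hence "\<bar>k\<bar> \<le> \<bar>18 * int u\<bar>" by (simp only: abs_le_square_iff)
    thus "k \<in> {- int (18 * u)..int (18 * u)}" by auto
  qed
  hence "card K \<le> card {- int (18 * u)..int (18 * u)}" by (rule card_mono[rotated]) simp
  also have "\<dots> \<le> 37 * u" using assms by simp
  finally have "card E * card K \<le> card E * (37 * u)" by simp
  with D have "u * (2 * u) \<le> card E * (37 * u)" by (rule le_trans)
  hence "u * (2 * u) \<le> u * (37 * card E)" by (simp only: ac_simps)
  thus ?thesis using assms unfolding E_def by simp
qed

theorem theorem1p12:
  shows "\<exists>c::real. c > 0 \<and>
    (\<forall>\<^sub>F X::real in at_top.
       real (card {n::nat. real n \<le> X \<and> even (b 14 (2 * n))}) \<ge> c * sqrt (X / 3))"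
\<comment> \<open>407 = 37 * 11: the factor 37 comes from \<open>card_even_ge\<close>, and 11 from
  301 / 3 < 11^2.\<close>
proof (intro exI[of _ "1 / 407"] conjI)
  show "\<forall>\<^sub>F X::real in at_top.
    real (card {n::nat. real n \<le> X \<and> even (b 14 (2 * n))}) \<ge> 1 / 407 * sqrt (X / 3)"
    using eventually_ge_at_top[of "301 :: real"]
  proof eventually_elim
    case (elim X)
    let ?S = "{n::nat. real n \<le> X \<and> even (b 14 (2 * n))}"
    define r where "r = sqrt (X / 301)"
    define u where "u = nat \<lfloor>r\<rfloor>"
    have "1 \<le> r" using elim by (simp add: r_def)
    hence u: "real u \<le> r" "r < real u + 1" "0 < u"
      unfolding u_def by linarith+
    have "(real u)\<^sup>2 \<le> r\<^sup>2" using u by (intro power_mono) auto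
    hence uX: "real (301 * u\<^sup>2) \<le> X" using elim by (simp add: r_def)
    have "?S \<subseteq> {..nat \<lfloor>X\<rfloor>}" by (auto simp: le_nat_floor)
    hence "finite ?S" by (rule finite_subset) simp
    moreover have "{m. m \<le> 301 * u\<^sup>2 \<and> even (b 14 (2 * m))} \<subseteq> ?S"
      using uX by (auto dest!: of_nat_mono[where 'a = real])
    ultimately have "card {m. m \<le> 301 * u\<^sup>2 \<and> even (b 14 (2 * m))} \<le> card ?S"
      by (intro card_mono)
    hence "real (2 * u) \<le> real (37 * card ?S)"
      using card_even_ge[OF u(3)] by (intro of_nat_mono) linarith
    \<comment> \<open>Since \<open>u\<close> is at least 1,
      \<open>r < u + 1 \<le> 2 * u\<close>.\<close>
    hence "r / 37 \<le> real (card ?S)" using u by simp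
    moreover have "sqrt (X / 3) \<le> 11 * r"
      using elim by (intro real_le_lsqrt) (auto simp: r_def power_mult_distrib)
    ultimately show ?case by simp
  qed
qed simp

end
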